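(* Let $K\in\mathcal{S}$. Then $\Pi_{\mathcal{F}}(\nabla J(K))=0$, where $\mathcal{F}=\{\Delta\in\mathbb{R}^{m\times q}:\Delta S^\dagger=0\}$ and $\Pi_{\mathcal{F}}$ is the orthogonal projection of $\mathbb{R}^{m\times q}$ onto $\mathcal{F}$.
   Context: System: $x_{t+1}=Ax_t+Bu_t$, $y_t=Cx_t$, with $x_t\in\mathbb{R}^n$, $u_t\in\mathbb{R}^m$, $y_t\in\mathbb{R}^d$. Standing assumptions: $(A,B)$ is controllable and $(C,A)$ is observable; the weights are symmetric, $Q\ge 0$ (size $d\times d$) and $R>0$ (size $m\times m$); the initial state $x_0$ is random with zero mean and covariance $\Sigma_0=\mathbb{E}[x_0x_0^\top]>0$. Let $p=\max\{o,c\}\le n$, where $o$ and $c$ are the observability and controllability indices, so that $\mathcal{O}=[(CA^{p-1})^\top,\dots,(CA)^\top,C^\top]^\top$ has full column rank and $\mathcal{C}=[B,AB,\dots,A^{p-1}B]$ has full row rank. Let $\mathcal{T}$ be the $p\times p$ block matrix with blocks in $\mathbb{R}^{d\times m}$ whose $(i,j)$ block is $CA^{j-i-1}B$ if $j>i$ and $0$ otherwise. Let $\mathcal{O}^\dagger=(\mathcal{O}^\top\mathcal{O})^{-1}\mathcal{O}^\top$, $q=p(m+d)$, and $$S=[\,\mathcal{C}-A^p\mathcal{O}^\dagger\mathcal{T},\ A^p\mathcal{O}^\dagger\,]\in\mathbb{R}^{n\times q}.$$ $S$ has full row rank; put $S^\dagger=S^\top(SS^\top)^{-1}$. With $z_{t,p}=[u_{t-1}^\top,\dots,u_{t-p}^\top,y_{t-1}^\top,\dots,y_{t-p}^\top]^\top$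 one has $x_t=Sz_{t,p}$. The policies considered are $u_t=-Kz_{t,p}$ with $K\in\mathbb{R}^{m\times q}$ (input-output feedback), and the feasible set is $\mathcal{S}=\{K\in\mathbb{R}^{m\times q} : \rho(A-BKS^\dagger)<1\}$, where $\rho$ is the spectral radius. Put $Q_c=C^\top QC$. For $K\in\mathcal{S}$ the cost (of $\sum_{t\ge0}(y_t^\top Qy_t+u_t^\top Ru_t)$ in expectation over $x_0$) is given by $J(K)=\mathrm{Tr}(P_K\Sigma_0)$, where $P_K\ge0$ is the solution of $P_K=Q_c+(S^\dagger)^\top K^\top RKS^\dagger+(A-BKS^\dagger)^\top P_K(A-BKS^\dagger)$. $\nabla J(K)\in\mathbb{R}^{m\times q}$ is the gradient, and orthogonality is with respect to the Frobenius inner product $\langle X,Y\rangle=\operatorname{tr}(X^\top Y)$. *)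

theory Defs
  imports "HOL-Probability.Probability"
begin

section \<open>Matrices\<close>

text \<open>The operations \<open>*\<close> and \<open>^\<close> on \<^typ>\<open>real^'n^'n\<close> are componentwise, hence a separate
  definition of the matrix power.\<close>

definition mpow :: "real^'n^'n \<Rightarrow> nat \<Rightarrow> real^'n^'n" where
  "mpow A k = (((**) A) ^^ k) (mat 1)"

definition symmetric_mat :: "real^'n^'n \<Rightarrow> bool" where
  "symmetric_mat M \<longleftrightarrow> transpose M = M"

definition psd :: "real^'n^'n \<Rightarrow> bool" where
  "psd M \<longleftrightarrow> symmetric_mat M \<and> (\<forall>x. 0 \<le> x \<bullet> (M *v x))"

definition pos_def :: "real^'n^'n \<Rightarrow> bool" where
  "pos_def M \<longleftrightarrow> symmetric_mat M \<and> (\<forall>x. x \<noteq> 0 \<longrightarrow> 0 < x \<bullet> (M *v x))"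

text \<open>The eigenvalues of a real matrix are its complex eigenvalues.\<close>

definition mat_spectrum :: "real^'n^'n \<Rightarrow> complex set" where
  "mat_spectrum M =
     {l. \<exists>v :: complex^'n. v \<noteq> 0 \<and> map_matrix complex_of_real M *v v = l *s v}"

definition mat_spectral_radius :: "real^'n^'n \<Rightarrow> real" where
  "mat_spectral_radius M = Max (cmod ` mat_spectrum M)"

text \<open>The two pseudo-inverses are meant for full column rank and full row rank, respectively.\<close>

definition left_pinv :: "real^'n^'k \<Rightarrow> real^'k^'n" where
  "left_pinv M = matrix_inv (transpose M ** M) ** transpose M"

definition right_pinv :: "real^'k^'n \<Rightarrow> real^'n^'k" where
  "right_pinv M = transpose M ** matrix_inv (M ** transpose M)"

text \<open>On matrices the inner product \<open>\<bullet>\<close> is the Frobenius inner product; gradients and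
  orthogonal projections of matrices below refer to it.\<close>

lemma inner_matrix_eq_trace: "X \<bullet> Y = trace (transpose X ** Y)" for X Y :: "real^'k^'l"
proof -
  have "X \<bullet> Y = (\<Sum>i\<in>UNIV. \<Sum>j\<in>UNIV. X $ i $ j * Y $ i $ j)"
    by (simp add: inner_vec_def)
  also have "\<dots> = (\<Sum>j\<in>UNIV. \<Sum>i\<in>UNIV. X $ i $ j * Y $ i $ j)"
    by (rule sum.swap)
  also have "\<dots> = trace (transpose X ** Y)"
    by (simp add: trace_def matrix_matrix_mult_def transpose_def)
  finally show ?thesis .
qed

definition gradient :: "('a::real_inner \<Rightarrow> real) \<Rightarrow> 'a \<Rightarrow> 'a" where
  "gradient f x = (THE D. GDERIV f x :> D)"

definition orth_proj :: "'a::real_inner set \<Rightarrow> 'a \<Rightarrow> 'a" where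
  "orth_proj F x = (THE y. y \<in> F \<and> (\<forall>w\<in>F. orthogonal (x - y) w))"


section \<open>Controllability and observability\<close>

text \<open>The number of blocks \<open>k\<close> is a variable here, so \<open>[B, AB, \<dots>, A\<^sup>k\<^sup>-\<^sup>1B]\<close> does not have
  a fixed matrix type. Its rank is written out as the dimension of its set of columns; dually, the
  rank of the stack of \<open>C, CA, \<dots>, CA\<^sup>k\<^sup>-\<^sup>1\<close> is the dimension of its set of rows.
  See \<open>rank_ctrb_mat\<close> and \<open>rank_obsv_mat\<close> below.\<close>

definition ctrb_rank :: "real^'n^'n \<Rightarrow> real^'m^'n \<Rightarrow> nat \<Rightarrow> nat" where
  "ctrb_rank A B k = dim (\<Union>i<k. columns (mpow A i ** B))"

definition obsv_rank :: "real^'n^'n \<Rightarrow> real^'n^'d \<Rightarrow> nat \<Rightarrow> nat" where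
  "obsv_rank A C k = dim (\<Union>i<k. rows (C ** mpow A i))"

definition controllable :: "real^'n^'n \<Rightarrow> real^'m^'n \<Rightarrow> bool" where
  "controllable A B \<longleftrightarrow> ctrb_rank A B CARD('n) = CARD('n)"

definition observable :: "real^'n^'d \<Rightarrow> real^'n^'n \<Rightarrow> bool" where
  "observable C A \<longleftrightarrow> obsv_rank A C CARD('n) = CARD('n)"

definition ctrb_index :: "real^'n^'n \<Rightarrow> real^'m^'n \<Rightarrow> nat" where
  "ctrb_index A B = (LEAST k. ctrb_rank A B k = CARD('n))"

definition obsv_index :: "real^'n^'n \<Rightarrow> real^'n^'d \<Rightarrow> nat" where
  "obsv_index A C = (LEAST k. obsv_rank A C k = CARD('n))"


section \<open>Block matrices\<close>

text \<open>The \<open>p\<close> blocks are indexed, in increasing order, by a finite linearly ordered type \<open>'p\<close>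
  with \<open>p\<close> elements; \<open>block_pos\<close> is the position of a block, counted from \<open>0\<close>.
  An index pair \<open>(i, r)\<close> is entry \<open>r\<close> of block \<open>i\<close>.\<close>

definition block_pos :: "'p::{finite,linorder} \<Rightarrow> nat" where
  "block_pos i = card {..<i}"

definition ctrb_mat :: "real^'n^'n \<Rightarrow> real^'m^'n \<Rightarrow> real^('p::{finite,linorder} \<times> 'm)^'n" where
  "ctrb_mat A B = (\<chi> r js. (mpow A (block_pos (fst js)) ** B) $ r $ snd js)"

text \<open>The top block is \<open>CA\<^sup>p\<^sup>-\<^sup>1\<close>, the bottom block is \<open>C\<close>.\<close>

definition obsv_mat :: "real^'n^'n \<Rightarrow> real^'n^'d \<Rightarrow> real^'n^('p::{finite,linorder} \<times> 'd)" where
  "obsv_mat A C = (\<chi> ir s. (C ** mpow A (CARD('p) - 1 - block_pos (fst ir))) $ snd ir $ s)"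

definition toep_mat ::
  "real^'n^'n \<Rightarrow> real^'m^'n \<Rightarrow> real^'n^'d \<Rightarrow> real^('p \<times> 'm)^('p::{finite,linorder} \<times> 'd)" where
  "toep_mat A B C = (\<chi> ir js.
     if fst ir < fst js
     then (C ** mpow A (block_pos (fst js) - block_pos (fst ir) - 1) ** B) $ snd ir $ snd js
     else 0)"

definition hcat :: "real^'a^'n \<Rightarrow> real^'b^'n \<Rightarrow> real^('a + 'b)^'n" where
  "hcat M N = (\<chi> r s. case s of Inl a \<Rightarrow> M $ r $ a | Inr b \<Rightarrow> N $ r $ b)"

text \<open>The index type \<open>'p \<times> 'm + 'p \<times> 'd\<close> of the stacked past inputs and outputs has
  \<open>q = p(m + d)\<close> elements.\<close>

definition S_mat :: "real^'n^'n \<Rightarrow> real^'m^'n \<Rightarrow> real^'n^'d \<Rightarrow>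
    real^(('p::{finite,linorder} \<times> 'm) + ('p \<times> 'd))^'n" where
  "S_mat A B C =
     (let Od = left_pinv (obsv_mat A C :: real^'n^('p \<times> 'd)); Ap = mpow A CARD('p)
      in hcat (ctrb_mat A B - Ap ** Od ** toep_mat A B C) (Ap ** Od))"

lemma bij_betw_block_pos:
  "bij_betw (block_pos :: 'p::{finite,linorder} \<Rightarrow> nat) UNIV {..<CARD('p)}"
proof -
  have mono: "block_pos i < block_pos j" if "i < j" for i j :: 'p
    unfolding block_pos_def using that by (intro psubset_card_mono) auto
  have inj: "inj (block_pos :: 'p \<Rightarrow> nat)"
    by (rule injI) (metis mono less_irrefl neqE)
  have "block_pos i < CARD('p)" for i :: 'p
    unfolding block_pos_def by (intro psubset_card_mono) auto
  then have "range (block_pos :: 'p \<Rightarrow> nat) \<subseteq> {..<CARD('p)}" by auto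
  moreover have "card (range (block_pos :: 'p \<Rightarrow> nat)) = CARD('p)"
    by (rule card_image[OF inj])
  ultimately have "range (block_pos :: 'p \<Rightarrow> nat) = {..<CARD('p)}"
    by (intro card_subset_eq) auto
  with inj show ?thesis by (simp add: bij_betw_def)
qed

lemma rank_ctrb_mat:
  "rank (ctrb_mat A B :: real^('p::{finite,linorder} \<times> 'm::finite)^'n) = ctrb_rank A B CARD('p)"
proof -
  have col: "column (j, s) (ctrb_mat A B :: real^('p \<times> 'm)^'n)
      = column s (mpow A (block_pos j) ** B)" for j s
    by (simp add: column_def ctrb_mat_def vec_eq_iff)
  have "columns (ctrb_mat A B :: real^('p \<times> 'm)^'n)
      = (\<Union>j::'p. columns (mpow A (block_pos j) ** B))"
    by (auto simp: columns_def col)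
  also have "\<dots> = (\<Union>i\<in>range (block_pos :: 'p \<Rightarrow> nat). columns (mpow A i ** B))"
    by auto
  also have "range (block_pos :: 'p \<Rightarrow> nat) = {..<CARD('p)}"
    using bij_betw_block_pos[where 'p='p] by (simp add: bij_betw_def)
  finally show ?thesis
    by (simp add: column_rank_def ctrb_rank_def)
qed

lemma rank_obsv_mat:
  "rank (obsv_mat A C :: real^'n^('p::{finite,linorder} \<times> 'd::finite)) = obsv_rank A C CARD('p)"
proof -
  have r: "row (i, s) (obsv_mat A C :: real^'n^('p \<times> 'd))
      = row s (C ** mpow A (CARD('p) - 1 - block_pos i))" for i s
    by (simp add: row_def obsv_mat_def vec_eq_iff)
  have "rows (obsv_mat A C :: real^'n^('p \<times> 'd))
      = (\<Union>i::'p. rows (C ** mpow A (CARD('p) - 1 - block_pos i)))"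
    by (auto simp: rows_def r)
  also have "\<dots> = (\<Union>i\<in>(\<lambda>k. CARD('p) - 1 - k) ` range (block_pos :: 'p \<Rightarrow> nat). rows (C ** mpow A i))"
    by auto
  also have "(\<lambda>k. CARD('p) - 1 - k) ` range (block_pos :: 'p \<Rightarrow> nat) = {..<CARD('p)}"
  proof -
    have "k \<in> (\<lambda>k. CARD('p) - 1 - k) ` {..<CARD('p)}" if "k < CARD('p)" for k
      using that by (intro image_eqI[of _ _ "CARD('p) - 1 - k"]) auto
    then show ?thesis
      using bij_betw_block_pos[where 'p='p] by (auto simp: bij_betw_def)
  qed
  finally show ?thesis
    by (simp add: row_rank_def obsv_rank_def)
qed


section \<open>Cost of input-output feedback\<close>

definition second_moment :: "'w measure \<Rightarrow> ('w \<Rightarrow> real^'n) \<Rightarrow> real^'n^'n" where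
  "second_moment M X = (\<chi> i j. \<integral>w. X w $ i * X w $ j \<partial>M)"

context
  fixes A :: "real^'n^'n" and B :: "real^'m^'n" and C :: "real^'n^'d"
begin

definition closed_loop ::
    "real^(('p::{finite,linorder} \<times> 'm) + ('p \<times> 'd))^'m \<Rightarrow> real^'n^'n" where
  "closed_loop K = A - B ** K ** right_pinv (S_mat A B C)"

definition feasible :: "(real^(('p::{finite,linorder} \<times> 'm) + ('p \<times> 'd))^'m) set" where
  "feasible = {K. mat_spectral_radius (closed_loop K) < 1}"

definition cost_mat :: "real^'d^'d \<Rightarrow> real^'m^'m \<Rightarrow>
    real^(('p::{finite,linorder} \<times> 'm) + ('p \<times> 'd))^'m \<Rightarrow> real^'n^'n" where
  "cost_mat Q R K = (THE P. psd P \<and>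
     P = transpose C ** Q ** C
       + transpose (right_pinv (S_mat A B C)) ** transpose K ** R ** K ** right_pinv (S_mat A B C)
       + transpose (closed_loop K) ** P ** closed_loop K)"

definition cost :: "real^'d^'d \<Rightarrow> real^'m^'m \<Rightarrow> real^'n^'n \<Rightarrow>
    real^(('p::{finite,linorder} \<times> 'm) + ('p \<times> 'd))^'m \<Rightarrow> real" where
  "cost Q R Sigma0 K = trace (cost_mat Q R K ** Sigma0)"

definition null_gains :: "(real^(('p::{finite,linorder} \<times> 'm) + ('p \<times> 'd))^'m) set" where
  "null_gains = {D. D ** right_pinv (S_mat A B C) = 0}"

end

end

theory Submission
  imports Defs "HOL-Computational_Algebra.Fundamental_Theorem_Algebra"
begin

text \<open>The cost \<open>J(K)\<close> depends on \<open>K\<close> only through the state gain \<open>K S\<^sup>\<dagger>\<close>, so it is constant on every line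
\<open>K + t \<Delta>\<close> with \<open>\<Delta> S\<^sup>\<dagger> = 0\<close> (\<open>cost_eq_if_state_gain_eq\<close>). If \<open>J\<close> has a gradient at \<open>K\<close>, that gradient
is therefore orthogonal to all such \<open>\<Delta>\<close>, and its projection onto them vanishes. The weight of the proof
lies in the condition: \<open>J\<close> has to be differentiable at \<open>K\<close> (\<open>cost_differentiable\<close>), because otherwise
\<open>gradient\<close> denotes nothing in particular.

Differentiability comes from the Stein equation \<open>P = N + L\<^sup>T P L\<close>, which defines the cost matrix; \<open>L\<close> is the
closed loop and \<open>N\<close> the running cost, both polynomial in \<open>K\<close>. It is a square linear system for the
entries of \<open>P\<close>. Where its determinant does not vanish, Cramer's rule expresses \<open>P\<close> as a quotient of
polynomials in the entries of \<open>L\<close> and \<open>N\<close>, so \<open>P\<close> is differentiable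
(\<open>differentiable_stein_solution\<close>).

The cost matrix must also be this unique solution, and positive semidefinite, for all gains
in a neighbourhood of \<open>K\<close>. For that purpose the condition on the spectral radius is replaced by
\<open>\<parallel>L\<^sup>k\<parallel> < 1\<close> for some fixed \<open>k\<close>. This condition is clearly open in \<open>K\<close>, it holds at \<open>K\<close> because
\<open>\<rho>(L) < 1\<close> forces \<open>L\<^sup>k \<rightarrow> 0\<close> (\<open>mpow_tendsto_0\<close>), and it suffices for uniqueness
(\<open>homogeneous_stein_trivial\<close>) and for semidefiniteness (\<open>stein_solution_psd\<close>).\<close>

section \<open>Polynomials acting on a vector through a matrix\<close>

definition poly_mv :: "complex poly \<Rightarrow> complex^'n^'n \<Rightarrow> complex^'n \<Rightarrow> complex^'n" where
  "poly_mv p M v = (\<Sum>i\<le>degree p. coeff p i *s (((*v) M) ^^ i) v)"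

lemma poly_mv_eq_sum:
  assumes "degree p \<le> N"
  shows "poly_mv p M v = (\<Sum>i\<le>N. coeff p i *s (((*v) M) ^^ i) v)"
  unfolding poly_mv_def using assms
  by (intro sum.mono_neutral_left) (auto simp: coeff_eq_0)

lemma poly_mv_0 [simp]: "poly_mv 0 M v = 0"
  by (simp add: poly_mv_def)

lemma poly_mv_pCons: "poly_mv (pCons a p) M v = a *s v + poly_mv p M (M *v v)"
proof -
  have "poly_mv (pCons a p) M v
      = (\<Sum>i\<le>Suc (degree p). coeff (pCons a p) i *s (((*v) M) ^^ i) v)"
    by (rule poly_mv_eq_sum) (simp add: degree_pCons_le)
  also have "\<dots> = a *s v + poly_mv p M (M *v v)"
    by (simp add: sum.atMost_Suc_shift poly_mv_def funpow_swap1 del: sum.atMost_Suc)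
  finally show ?thesis .
qed

lemma poly_mv_add: "poly_mv (p + q) M v = poly_mv p M v + poly_mv q M v"
proof -
  let ?N = "max (degree p) (degree q)"
  have "poly_mv (p + q) M v = (\<Sum>i\<le>?N. coeff (p + q) i *s (((*v) M) ^^ i) v)"
    by (rule poly_mv_eq_sum) (simp add: degree_add_le_max)
  also have "\<dots> = poly_mv p M v + poly_mv q M v"
    by (simp add: poly_mv_eq_sum[of p ?N] poly_mv_eq_sum[of q ?N] sum.distrib
        vec.scale_left_distrib)
  finally show ?thesis .
qed

lemma poly_mv_smult: "poly_mv (smult c p) M v = c *s poly_mv p M v"
  by (simp add: poly_mv_eq_sum[of "smult c p" "degree p"] poly_mv_def degree_smult_le
      vec.scale_sum_right)

lemma poly_mv_apply: "poly_mv p M (M *v v) = M *v poly_mv p M v"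
  by (induction p arbitrary: v)
     (simp_all add: poly_mv_pCons matrix_vector_right_distrib vector_scalar_commute)

lemma poly_mv_diff_vec: "poly_mv p M (u - v) = poly_mv p M u - poly_mv p M v"
  by (induction p arbitrary: u v)
     (simp_all add: poly_mv_pCons matrix_vector_mult_diff_distrib vec.scale_right_diff_distrib)

lemma poly_mv_scale_vec: "poly_mv p M (c *s v) = c *s poly_mv p M v"
  by (induction p arbitrary: v)
     (simp_all add: poly_mv_pCons vector_scalar_commute vec.scale_right_distrib mult.commute)

text \<open>A root \<open>l\<close> of an annihilating polynomial can be traded for one application of \<open>M - l\<close> to the vector,
which lowers the degree.\<close>
lemma poly_mv_linear_factor:
  "poly_mv ([:- l, 1:] * q) M v = poly_mv q M (M *v v - l *s v)"
proof -
  have "[:- l, 1:] * q = smult (- l) q + pCons 0 q" by simp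
  then show ?thesis
    by (simp only: poly_mv_add poly_mv_smult poly_mv_pCons poly_mv_diff_vec poly_mv_scale_vec)
       simp
qed

lemma poly_mv_eigenvector:
  assumes "M *v v = l *s v"
  shows "poly_mv p M v = poly p l *s v"
  by (induction p)
     (simp_all add: poly_mv_pCons assms poly_mv_scale_vec vec.scale_left_distrib)

section \<open>Powers of a matrix of spectral radius below one\<close>

text \<open>Past the point where the perturbation \<open>b\<close> is below \<open>e (1 - r) / 2\<close>, the recursion contracts
towards the fixed point \<open>e / 2\<close>.\<close>
lemma perturbed_contraction_tendsto_0:
  fixes a b :: "nat \<Rightarrow> real"
  assumes a: "\<And>k. 0 \<le> a k" and step: "\<And>k. a (Suc k) \<le> r * a k + b k"
    and r: "0 \<le> r" "r < 1" and b: "b \<longlonglongrightarrow> 0"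
  shows "a \<longlonglongrightarrow> 0"
proof (rule LIMSEQ_I)
  fix e :: real assume e: "0 < e"
  have "0 < e * (1 - r) / 2" using e r by simp
  from LIMSEQ_D[OF b this] obtain N where N: "\<And>k. k \<ge> N \<Longrightarrow> \<bar>b k\<bar> < e * (1 - r) / 2"
    by auto
  have bound: "a (N + j) \<le> r ^ j * a N + e / 2" for j
  proof (induction j)
    case 0
    then show ?case using e by simp
  next
    case (Suc j)
    have "a (N + Suc j) \<le> r * a (N + j) + b (N + j)" using step by simp
    also have "\<dots> \<le> r * (r ^ j * a N + e / 2) + e * (1 - r) / 2"
      using Suc N[of "N + j"] r by (intro add_mono mult_left_mono) auto
    also have "\<dots> = r ^ Suc j * a N + e / 2" by (simp add: field_simps)
    finally show ?case .
  qed
  have "(\<lambda>j. r ^ j * a N) \<longlonglongrightarrow> 0"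
    using r by (intro tendsto_mult_left_zero LIMSEQ_realpow_zero)
  from LIMSEQ_D[OF this, of "e / 2"] e obtain J where
    J: "\<And>j. j \<ge> J \<Longrightarrow> \<bar>r ^ j * a N\<bar> < e / 2" by auto
  have "norm (a k - 0) < e" if "k \<ge> N + J" for k
  proof -
    have "a k \<le> r ^ (k - N) * a N + e / 2" using bound[of "k - N"] that by simp
    moreover have "\<bar>r ^ (k - N) * a N\<bar> < e / 2" using that by (intro J) simp
    ultimately show ?thesis using a[of k] by simp
  qed
  then show "\<exists>n0. \<forall>k\<ge>n0. norm (a k - 0) < e" by blast
qed

lemma norm_scale_complex: "norm (c *s (v :: complex^'n)) = cmod c * norm v"
  by (simp add: norm_vec_def L2_set_def norm_mult power_mult_distrib sum_distrib_left[symmetric]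
      real_sqrt_mult)

text \<open>Let a nonzero polynomial \<open>p\<close> annihilate \<open>v\<close>, with \<open>p = (z - l) q\<close>. If \<open>\<bar>l\<bar> < 1\<close>, then \<open>q\<close> annihilates
\<open>u = (M - l) v\<close>, so the iterates of \<open>u\<close> vanish by induction on the degree, and
\<open>M\<^sup>k\<^sup>+\<^sup>1 v = l M\<^sup>k v + M\<^sup>k u\<close> is a contraction with a vanishing perturbation. If \<open>\<bar>l\<bar> \<ge> 1\<close>, then \<open>l\<close> is not
an eigenvalue by hypothesis, so \<open>M - l\<close> is injective and already \<open>q\<close> annihilates \<open>v\<close>. This gives the
decay without a Jordan form.\<close>
lemma iterates_tendsto_0_of_annihilator:
  fixes M :: "complex^'n^'n"
  assumes ev: "\<And>l v. v \<noteq> 0 \<Longrightarrow> M *v v = l *s v \<Longrightarrow> cmod l < 1"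
    and "p \<noteq> 0" and "poly_mv p M v = 0"
  shows "(\<lambda>k. (((*v) M) ^^ k) v) \<longlonglongrightarrow> 0"
  using assms(2,3)
proof (induction "degree p" arbitrary: p v rule: less_induct)
  case less
  show ?case
  proof (cases "degree p = 0")
    case True
    then obtain c where "p = [:c:]" by (metis degree_eq_zeroE)
    with less.prems have "v = 0" by (simp add: poly_mv_pCons)
    moreover have "(((*v) M) ^^ k) 0 = 0" for k by (induction k) auto
    ultimately show ?thesis by simp
  next
    case False
    then obtain l where "poly p l = 0"
      using fundamental_theorem_of_algebra[of p] constant_degree[of p] by auto
    then obtain q where p: "p = [:- l, 1:] * q" by (auto simp: poly_eq_0_iff_dvd)
    with less.prems have q: "q \<noteq> 0" by auto
    with p have deg: "degree q < degree p"
      by (subst p, subst degree_mult_eq) auto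
    define u where "u = M *v v - l *s v"
    have qu: "poly_mv q M u = 0"
      using less.prems(2) by (simp only: p poly_mv_linear_factor u_def)
    show ?thesis
    proof (cases "cmod l < 1")
      case True
      have u0: "(\<lambda>k. (((*v) M) ^^ k) u) \<longlonglongrightarrow> 0" by (rule less.hyps[OF deg q qu])
      have rec: "(((*v) M) ^^ Suc k) v = l *s (((*v) M) ^^ k) v + (((*v) M) ^^ k) u" for k
      proof (induction k)
        case 0
        then show ?case by (simp add: u_def)
      next
        case (Suc k)
        have "(((*v) M) ^^ Suc (Suc k)) v = M *v ((((*v) M) ^^ Suc k) v)" by simp
        also have "\<dots> = l *s (((*v) M) ^^ Suc k) v + (((*v) M) ^^ Suc k) u"
          by (subst Suc) (simp add: matrix_vector_right_distrib vector_scalar_commute)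
        finally show ?case .
      qed
      have "(\<lambda>k. norm ((((*v) M) ^^ k) v)) \<longlonglongrightarrow> 0"
      proof (rule perturbed_contraction_tendsto_0[where r = "cmod l"])
        show "norm ((((*v) M) ^^ Suc k) v)
            \<le> cmod l * norm ((((*v) M) ^^ k) v) + norm ((((*v) M) ^^ k) u)" for k
          unfolding rec norm_scale_complex[symmetric] by (rule norm_triangle_ineq)
      qed (use True tendsto_norm_zero[OF u0] in auto)
      then show ?thesis by (rule tendsto_norm_zero_cancel)
    next
      case outside: False
      have "poly_mv q M v = 0"
      proof (rule ccontr)
        assume "poly_mv q M v \<noteq> 0"
        moreover have "M *v poly_mv q M v = l *s poly_mv q M v"
          using qu by (simp add: u_def poly_mv_diff_vec poly_mv_scale_vec poly_mv_apply)
        ultimately show False using ev outside by blast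
      qed
      then show ?thesis by (rule less.hyps[OF deg q])
    qed
  qed
qed

lemma mpow_0 [simp]: "mpow L 0 = mat 1"
  by (simp add: mpow_def)

lemma mpow_Suc: "mpow L (Suc k) = L ** mpow L k"
  by (simp add: mpow_def)

lemma map_matrix_of_real_mult:
  "map_matrix complex_of_real (X ** Y) = map_matrix complex_of_real X ** map_matrix complex_of_real Y"
  by (simp add: vec_eq_iff matrix_matrix_mult_def)

lemma iterate_complexified_mpow:
  fixes L :: "real^'n^'n"
  shows   "(((*v) (map_matrix complex_of_real L)) ^^ k) v = map_matrix complex_of_real (mpow L k) *v v"
proof (induction k)
  case 0
  have "map_matrix complex_of_real (mat 1 :: real^'n^'n) = mat 1" by (simp add: vec_eq_iff mat_def)
  then show ?case by simp
next
  case (Suc k)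
  then show ?case by (simp add: mpow_Suc map_matrix_of_real_mult matrix_vector_mul_assoc)
qed

text \<open>The coefficients are attached to indices rather than to vectors, so a repeated value of the sequence
counts as a dependence.\<close>
lemma finite_dim_sequence_dependent:
  fixes a :: "nat \<Rightarrow> 'a::euclidean_space"
  obtains c where "\<exists>i\<le>DIM('a). c i \<noteq> 0" "(\<Sum>i\<le>DIM('a). c i *\<^sub>R a i) = 0"
proof (cases "inj_on a {..DIM('a)}")
  case True
  have "dependent (a ` {..DIM('a)})"
    by (rule dependent_biggerset) (simp add: card_image True)
  then obtain u where u: "\<exists>v\<in>a ` {..DIM('a)}. u v \<noteq> 0"
      "(\<Sum>v\<in>a ` {..DIM('a)}. u v *\<^sub>R v) = 0"
    by (auto simp: dependent_finite)
  have "(\<Sum>i\<le>DIM('a). u (a i) *\<^sub>R a i) = 0"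
    using u(2) by (simp add: sum.reindex[OF True])
  with u(1) show ?thesis by (intro that[of "u \<circ> a"]) auto
next
  case False
  then obtain i j where ij: "i \<le> DIM('a)" "j \<le> DIM('a)" "i \<noteq> j" "a i = a j"
    by (auto simp: inj_on_def)
  let ?c = "\<lambda>k. (if k = i then 1 else 0) - (if k = j then 1 else 0 :: real)"
  have "(\<Sum>k\<le>DIM('a). ?c k *\<^sub>R a k)
      = (\<Sum>k\<le>DIM('a). if k = i then a k else 0) - (\<Sum>k\<le>DIM('a). if k = j then a k else 0)"
    by (simp only: sum_subtractf[symmetric]) (rule sum.cong, auto simp: algebra_simps)
  also have "\<dots> = 0" using ij by (simp add: sum.delta)
  finally show ?thesis using ij by (intro that[of ?c]) auto
qed

text \<open>The powers of \<open>L\<close> lie in the finite-dimensional space of matrices and so satisfy a linear relation.\<close>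
lemma annihilating_polynomial:
  fixes L :: "real^'n^'n"
  obtains p where "p \<noteq> 0" "\<And>v. poly_mv p (map_matrix complex_of_real L) v = 0"
proof -
  let ?N = "DIM(real^'n^'n)"
  obtain c where c: "\<exists>i\<le>?N. c i \<noteq> 0" "(\<Sum>i\<le>?N. c i *\<^sub>R mpow L i) = 0"
    by (rule finite_dim_sequence_dependent)
  define p where "p = (\<Sum>i\<le>?N. monom (complex_of_real (c i)) i)"
  have coeff: "coeff p i = (if i \<le> ?N then complex_of_real (c i) else 0)" for i
    by (simp add: p_def coeff_sum sum.delta)
  have "p \<noteq> 0" using c(1) coeff by (metis coeff_0 of_real_eq_0_iff)
  moreover have "poly_mv p (map_matrix complex_of_real L) v = 0" for v
  proof -
    have "degree p \<le> ?N" by (rule degree_le) (simp add: coeff)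
    then have "poly_mv p (map_matrix complex_of_real L) v
        = (\<Sum>i\<le>?N. complex_of_real (c i) *s (map_matrix complex_of_real (mpow L i) *v v))"
      by (simp add: poly_mv_eq_sum coeff iterate_complexified_mpow)
    also have "\<dots> = map_matrix complex_of_real (\<Sum>i\<le>?N. c i *\<^sub>R mpow L i) *v v"
      by (simp add: vec_eq_iff matrix_vector_mult_def sum_distrib_left sum_distrib_right mult.assoc
          sum.swap[of _ _ "UNIV :: 'n set"])
    also have "\<dots> = 0" unfolding c(2) by (simp add: vec_eq_iff matrix_vector_mult_def)
    finally show ?thesis .
  qed
  ultimately show ?thesis by (rule that)
qed

text \<open>Every eigenvalue is a root of an annihilating polynomial. Finiteness gives the maximum in
\<open>mat_spectral_radius\<close> its meaning as a bound on all eigenvalues.\<close>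
lemma finite_mat_spectrum: "finite (mat_spectrum L)"
proof -
  obtain p where p: "p \<noteq> 0" "\<And>v. poly_mv p (map_matrix complex_of_real L) v = 0"
    using annihilating_polynomial by blast
  have "mat_spectrum L \<subseteq> {l. poly p l = 0}"
  proof
    fix l assume "l \<in> mat_spectrum L"
    then obtain v where "v \<noteq> 0" "map_matrix complex_of_real L *v v = l *s v"
      by (auto simp: mat_spectrum_def)
    with p(2)[of v] show "l \<in> {l. poly p l = 0}" by (simp add: poly_mv_eigenvector)
  qed
  then show ?thesis using poly_roots_finite[OF p(1)] finite_subset by blast
qed

lemma mpow_tendsto_0:
  fixes L :: "real^'n^'n"
  assumes "mat_spectral_radius L < 1"
  shows "(\<lambda>k. mpow L k) \<longlonglongrightarrow> 0"
proof -
  let ?M = "map_matrix complex_of_real L"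
  obtain p where p: "p \<noteq> 0" "\<And>v. poly_mv p ?M v = 0"
    using annihilating_polynomial by blast
  have ev: "cmod l < 1" if "v \<noteq> 0" "?M *v v = l *s v" for l v
  proof -
    have "l \<in> mat_spectrum L" using that by (auto simp: mat_spectrum_def)
    then have "cmod l \<le> mat_spectral_radius L"
      unfolding mat_spectral_radius_def by (intro Max_ge) (auto simp: finite_mat_spectrum)
    with assms show ?thesis by simp
  qed
  have "(\<lambda>k. map_matrix complex_of_real (mpow L k) *v axis j 1) \<longlonglongrightarrow> 0" for j
    using iterates_tendsto_0_of_annihilator[OF ev p(1) p(2)]
    by (simp add: iterate_complexified_mpow)
  from tendsto_vec_nth[OF this]
  have "(\<lambda>k. (map_matrix complex_of_real (mpow L k) *v axis j 1) $ i) \<longlonglongrightarrow> 0" for i j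
    by (simp only: zero_index)
  then have "(\<lambda>k. complex_of_real (mpow L k $ i $ j)) \<longlonglongrightarrow> complex_of_real 0" for i j
    by (simp add: matrix_vector_mult_def axis_def if_distrib[where f = "(*) _"] cong: if_cong)
  then have "(\<lambda>k. mpow L k $ i $ j) \<longlonglongrightarrow> 0" for i j
    unfolding tendsto_of_real_iff .
  then show ?thesis by (intro vec_tendstoI) simp
qed

section \<open>The Stein equation\<close>

text \<open>The norm of a matrix is its Frobenius norm, so this is Cauchy-Schwarz in each row.\<close>
lemma norm_matrix_vector_mult_le: "norm (M *v x) \<le> norm M * norm x"
  for M :: "real^'a^'b"
proof -
  have "norm (M *v x) = L2_set (\<lambda>i. \<bar>M $ i \<bullet> x\<bar>) UNIV"
    by (simp add: norm_vec_def matrix_vector_mul_component)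
  also have "\<dots> \<le> L2_set (\<lambda>i. norm (M $ i) * norm x) UNIV"
    by (intro L2_set_mono Cauchy_Schwarz_ineq2) simp
  also have "\<dots> = norm M * norm x"
    by (subst norm_vec_def) (simp add: L2_set_left_distrib)
  finally show ?thesis .
qed

lemma norm_transpose: "norm (transpose M) = norm M" for M :: "real^'a^'b"
proof -
  have "transpose M \<bullet> transpose M = (\<Sum>i\<in>UNIV. \<Sum>j\<in>UNIV. M $ j $ i * M $ j $ i)"
    by (simp add: inner_vec_def transpose_def)
  also have "\<dots> = (\<Sum>j\<in>UNIV. \<Sum>i\<in>UNIV. M $ j $ i * M $ j $ i)" by (rule sum.swap)
  also have "\<dots> = M \<bullet> M" by (simp add: inner_vec_def)
  finally show ?thesis by (simp add: norm_eq_sqrt_inner)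
qed

lemma norm_matrix_mult_le: "norm (M ** N) \<le> norm M * norm N"
  for M :: "real^'a^'b" and N :: "real^'c^'a"
proof -
  have row: "(M ** N) $ i = transpose N *v M $ i" for i
    by (simp add: vec_eq_iff matrix_matrix_mult_def vector_matrix_mult_def mult.commute)
  have "norm (M ** N) = L2_set (\<lambda>i. norm (transpose N *v M $ i)) UNIV"
    unfolding norm_vec_def[of "M ** N"] row ..
  also have "\<dots> \<le> L2_set (\<lambda>i. norm N * norm (M $ i)) UNIV"
    using norm_matrix_vector_mult_le[of "transpose N"] unfolding norm_transpose
    by (intro L2_set_mono) auto
  also have "\<dots> = norm M * norm N"
    by (subst norm_vec_def[of M]) (simp add: L2_set_right_distrib mult.commute)
  finally show ?thesis .
qed

lemma matrix_mult_diff_left: "(X - Y) ** Z = X ** Z - Y ** Z" for X Y :: "real^'a^'b"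
  by (simp add: vec_eq_iff matrix_matrix_mult_def left_diff_distrib sum_subtractf)

lemma matrix_mult_diff_right: "Z ** (X - Y) = Z ** X - Z ** Y" for X Y :: "real^'a^'b"
  by (simp add: vec_eq_iff matrix_matrix_mult_def right_diff_distrib sum_subtractf)

lemma quadratic_form_congruence: "x \<bullet> ((transpose M ** P ** M) *v x) = (M *v x) \<bullet> (P *v (M *v x))"
  for M :: "real^'a^'b"
  by (metis dot_lmul_matrix inner_commute matrix_vector_mul_assoc transpose_matrix_vector)

lemma homogeneous_stein_iterate:
  assumes "D = transpose L ** D ** L"
  shows "D = transpose (mpow L k) ** D ** mpow L k"
proof (induction k)
  case 0
  then show ?case by simp
next
  case (Suc k)
  have "transpose (mpow L (Suc k)) ** D ** mpow L (Suc k)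
      = transpose (mpow L k) ** (transpose L ** D ** L) ** mpow L k"
    by (simp add: mpow_Suc matrix_transpose_mul matrix_mul_assoc)
  with Suc assms show ?case by simp
qed

text \<open>Iterating the equation gives \<open>\<parallel>D\<parallel> \<le> \<parallel>L\<^sup>k\<parallel>\<^sup>2 \<parallel>D\<parallel>\<close>.\<close>
lemma homogeneous_stein_trivial:
  assumes "D = transpose L ** D ** L" and "norm (mpow L k) < 1"
  shows "D = 0"
proof (rule ccontr)
  assume "D \<noteq> 0"
  let ?c = "norm (mpow L k)"
  have "norm D = norm (transpose (mpow L k) ** D ** mpow L k)"
    using homogeneous_stein_iterate[OF assms(1)] by metis
  also have "\<dots> \<le> ?c * norm D * ?c"
    using norm_matrix_mult_le[of "transpose (mpow L k)" D]
    by (intro order_trans[OF norm_matrix_mult_le] mult_right_mono) (auto simp: norm_transpose)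
  also have "\<dots> = ?c\<^sup>2 * norm D" by (simp add: power2_eq_square)
  also have "\<dots> < 1 * norm D"
    using assms(2) \<open>D \<noteq> 0\<close> by (intro mult_strict_right_mono) (auto simp: power2_eq_1_iff power_less_one_iff)
  finally show False by simp
qed

text \<open>The quadratic form of \<open>P\<close> is a Lyapunov function: along one step of \<open>L\<close> it drops by the value of the form
of \<open>N\<close>.\<close>
lemma stein_form_decreasing:
  assumes P: "P = N + transpose L ** P ** L" and "psd N"
  shows "(mpow L k *v x) \<bullet> (P *v (mpow L k *v x)) \<le> x \<bullet> (P *v x)"
proof (induction k)
  case 0
  then show ?case by simp
next
  case (Suc k)
  let ?y = "mpow L k *v x"
  have "?y \<bullet> (P *v ?y) = ?y \<bullet> (N *v ?y) + (L *v ?y) \<bullet> (P *v (L *v ?y))"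
    by (subst P) (simp only: matrix_vector_mult_add_rdistrib inner_add_right quadratic_form_congruence)
  moreover have "0 \<le> ?y \<bullet> (N *v ?y)" using \<open>psd N\<close> by (simp add: psd_def)
  ultimately have "(L *v ?y) \<bullet> (P *v (L *v ?y)) \<le> ?y \<bullet> (P *v ?y)" by simp
  with Suc show ?case by (simp add: mpow_Suc matrix_vector_mul_assoc)
qed

text \<open>A negative minimum of the form on the unit sphere is impossible: \<open>L\<^sup>k\<close> shrinks the minimiser and so,
by homogeneity, would strictly increase the value of the form, whereas the form cannot increase
along \<open>L\<close>.\<close>
lemma stein_solution_nonneg:
  assumes P: "P = N + transpose L ** P ** L" and "psd N" and c: "norm (mpow L k) < 1"
  shows "0 \<le> x \<bullet> (P *v x)"
proof -
  let ?S = "sphere 0 1 :: (real^'a) set"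
  let ?q = "\<lambda>x. x \<bullet> (P *v x)"
  have "?S \<noteq> {}" by (metis norm_axis_1 dist_0_norm mem_sphere empty_iff)
  moreover have "continuous_on ?S ?q"
    by (intro continuous_intros matrix_vector_mult_linear_continuous_on)
  ultimately obtain e where e: "e \<in> ?S" and emin: "\<And>y. y \<in> ?S \<Longrightarrow> ?q e \<le> ?q y"
    using continuous_attains_inf[of ?S ?q] by auto
  have lower: "?q e * (norm y)\<^sup>2 \<le> ?q y" for y
  proof (cases "y = 0")
    case False
    have "?q e \<le> ?q ((1 / norm y) *\<^sub>R y)" using False by (intro emin) simp
    also have "\<dots> = ?q y / (norm y)\<^sup>2"
      by (simp add: matrix_vector_mult_scaleR power2_eq_square)
    finally show ?thesis using False by (simp add: field_simps)
  qed simp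
  have "0 \<le> ?q e"
  proof (rule ccontr)
    assume neg: "\<not> 0 \<le> ?q e"
    let ?y = "mpow L k *v e"
    have "norm ?y \<le> norm (mpow L k) * norm e" by (rule norm_matrix_vector_mult_le)
    also have "\<dots> < 1" using e c by simp
    finally have "(norm ?y)\<^sup>2 < 1" by (simp add: power_less_one_iff)
    then have "?q e < ?q e * (norm ?y)\<^sup>2" using neg by (simp add: mult_less_cancel_left2)
    also have "\<dots> \<le> ?q ?y" by (rule lower)
    also have "\<dots> \<le> ?q e" by (rule stein_form_decreasing[OF P \<open>psd N\<close>])
    finally show False by simp
  qed
  then have "0 \<le> ?q e * (norm x)\<^sup>2" by simp
  with lower[of x] show ?thesis by linarith
qed

lemma stein_solution_unique:
  assumes "P = N + transpose L ** P ** L" and "P' = N + transpose L ** P' ** L"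
    and "norm (mpow L k) < 1"
  shows "P = P'"
proof -
  have "P - P' = transpose L ** (P - P') ** L"
    using assms(1,2)
    by (metis add_diff_cancel_left matrix_mult_diff_left matrix_mult_diff_right)
  from homogeneous_stein_trivial[OF this assms(3)] show ?thesis by simp
qed

lemma transpose_add: "transpose (X + Y) = transpose X + transpose Y"
  by (simp add: vec_eq_iff transpose_def)

lemma stein_solution_psd:
  assumes P: "P = N + transpose L ** P ** L" and N: "psd N" and c: "norm (mpow L k) < 1"
  shows "psd P"
proof -
  have "transpose P = transpose (N + transpose L ** P ** L)" using P by simp
  also have "\<dots> = N + transpose L ** transpose P ** L"
    using N by (simp add: transpose_add matrix_transpose_mul matrix_mul_assoc psd_def symmetric_mat_def)
  finally have "transpose P = P" using P c by (rule stein_solution_unique)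
  then show ?thesis
    using stein_solution_nonneg[OF assms] by (simp add: psd_def symmetric_mat_def)
qed

section \<open>Differentiable dependence of the solution on the data\<close>

text \<open>The matrix of the linear map \<open>P \<mapsto> P - L\<^sup>T P L\<close> on the entries of \<open>P\<close>; writing it out makes determinants
and Cramer's rule applicable.\<close>
definition stein_mat :: "real^'n^'n \<Rightarrow> real^('n \<times> 'n)^('n \<times> 'n)" where
  "stein_mat L = (\<chi> ij kl. (if ij = kl then 1 else 0) - L $ fst kl $ fst ij * L $ snd kl $ snd ij)"

definition vectorize :: "real^'n^'n \<Rightarrow> real^('n \<times> 'n)" where
  "vectorize P = (\<chi> ij. P $ fst ij $ snd ij)"

text \<open>Cramer's formula for the solution of \<open>P - L\<^sup>T P L = N\<close>.\<close>
definition stein_solution :: "real^'n^'n \<Rightarrow> real^'n^'n \<Rightarrow> real^'n^'n" where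
  "stein_solution L N = (\<chi> i j.
     det (\<chi> ab kl. if kl = (i, j) then vectorize N $ ab else stein_mat L $ ab $ kl)
       / det (stein_mat L))"

lemma vectorize_inject: "vectorize P = vectorize P' \<longleftrightarrow> P = P'"
  by (auto simp: vectorize_def vec_eq_iff)

lemma stein_mat_mult_vectorize:
  "stein_mat L *v vectorize P = vectorize (P - transpose L ** P ** L)"
proof -
  have "(stein_mat L *v vectorize P) $ (i, j) = (P - transpose L ** P ** L) $ i $ j" for i j
  proof -
    have "(stein_mat L *v vectorize P) $ (i, j)
        = (\<Sum>kl\<in>UNIV. ((if (i, j) = kl then 1 else 0) - L $ fst kl $ i * L $ snd kl $ j)
             * P $ fst kl $ snd kl)"
      by (simp add: matrix_vector_mult_def stein_mat_def vectorize_def)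
    also have "\<dots> = (\<Sum>kl\<in>UNIV. (if (i, j) = kl then P $ i $ j else 0))
        - (\<Sum>kl\<in>UNIV. L $ fst kl $ i * L $ snd kl $ j * P $ fst kl $ snd kl)"
      unfolding sum_subtractf[symmetric] by (rule sum.cong) (auto simp: algebra_simps)
    also have "\<dots> = P $ i $ j
        - (\<Sum>k\<in>UNIV. \<Sum>l\<in>UNIV. L $ k $ i * L $ l $ j * P $ k $ l)"
      by (simp add: sum.delta' sum.cartesian_product case_prod_beta flip: UNIV_Times_UNIV)
    also have "(\<Sum>k\<in>UNIV. \<Sum>l\<in>UNIV. L $ k $ i * L $ l $ j * P $ k $ l)
        = (transpose L ** P ** L) $ i $ j"
      by (subst sum.swap)
         (simp add: matrix_matrix_mult_def transpose_def sum_distrib_right sum_distrib_left mult_ac)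
    finally show ?thesis by simp
  qed
  then show ?thesis by (simp add: vec_eq_iff vectorize_def split_paired_all)
qed

lemma stein_iff_solution:
  assumes "det (stein_mat L) \<noteq> 0"
  shows "P = N + transpose L ** P ** L \<longleftrightarrow> P = stein_solution L N"
proof -
  have "P = N + transpose L ** P ** L \<longleftrightarrow> P - transpose L ** P ** L = N"
    by (auto simp: algebra_simps)
  also have "\<dots> \<longleftrightarrow> stein_mat L *v vectorize P = vectorize N"
    by (simp add: stein_mat_mult_vectorize vectorize_inject)
  also have "\<dots> \<longleftrightarrow> vectorize P = vectorize (stein_solution L N)"
    unfolding cramer[OF assms] by (auto simp: vec_eq_iff vectorize_def stein_solution_def)
  finally show ?thesis by (simp add: vectorize_inject)
qed

lemma det_stein_mat_nonzero:
  assumes "norm (mpow L k) < 1"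
  shows "det (stein_mat L) \<noteq> 0"
proof
  assume "det (stein_mat L) = 0"
  then obtain v where v: "v \<noteq> 0" "stein_mat L *v v = 0"
    by (metis invertible_det_nz invertible_left_inverse matrix_left_invertible_ker)
  define D where "D = (\<chi> i j. v $ (i, j))"
  have vD: "v = vectorize D" by (simp add: D_def vectorize_def vec_eq_iff)
  have "vectorize (D - transpose L ** D ** L) = vectorize 0"
    using v(2) unfolding vD stein_mat_mult_vectorize by (simp add: vectorize_def vec_eq_iff)
  then have "D = transpose L ** D ** L" by (simp add: vectorize_inject)
  from homogeneous_stein_trivial[OF this assms] v(1) show False
    unfolding vD by (simp add: vectorize_def vec_eq_iff)
qed

lemma the_psd_stein_solution:
  assumes "norm (mpow L k) < 1" and "psd N"
  shows "(THE P. psd P \<and> P = N + transpose L ** P ** L) = stein_solution L N"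
  using stein_iff_solution[OF det_stein_mat_nonzero[OF assms(1)]] stein_solution_psd[OF _ assms(2,1)]
  by (intro the_equality) blast+

lemma differentiable_prod:
  fixes f :: "'i \<Rightarrow> 'a::real_normed_vector \<Rightarrow> real"
  assumes "\<And>i. i \<in> I \<Longrightarrow> f i differentiable (at a)"
  shows "(\<lambda>x. \<Prod>i\<in>I. f i x) differentiable (at a)"
  using assms by (induction I rule: infinite_finite_induct) auto

lemma differentiable_det:
  fixes F :: "'a::real_normed_vector \<Rightarrow> real^'n^'n"
  assumes "\<And>i j. (\<lambda>x. F x $ i $ j) differentiable (at a)"
  shows "(\<lambda>x. det (F x)) differentiable (at a)"
  unfolding det_def
  by (intro differentiable_sum ballI differentiable_mult differentiable_const differentiable_prod
      assms finite_permutations finite)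

lemma differentiable_matrix_mult:
  fixes F :: "'a::real_normed_vector \<Rightarrow> real^'k^'l" and G :: "'a \<Rightarrow> real^'m^'k"
  assumes "\<And>i j. (\<lambda>x. F x $ i $ j) differentiable (at a)"
    and "\<And>i j. (\<lambda>x. G x $ i $ j) differentiable (at a)"
  shows "(\<lambda>x. (F x ** G x) $ i $ j) differentiable (at a)"
  unfolding matrix_matrix_mult_def using assms by simp

lemma differentiable_stein_solution:
  fixes L N :: "'a::real_normed_vector \<Rightarrow> real^'n^'n"
  assumes L: "\<And>i j. (\<lambda>x. L x $ i $ j) differentiable (at a)"
    and N: "\<And>i j. (\<lambda>x. N x $ i $ j) differentiable (at a)"
    and "det (stein_mat (L a)) \<noteq> 0"
  shows "(\<lambda>x. stein_solution (L x) (N x) $ i $ j) differentiable (at a)"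
proof -
  have S: "(\<lambda>x. stein_mat (L x) $ ab $ kl) differentiable (at a)" for ab kl
    unfolding stein_mat_def using L by simp
  have V: "(\<lambda>x. vectorize (N x) $ ab) differentiable (at a)" for ab
    unfolding vectorize_def using N by simp
  have "(\<lambda>x. (\<chi> ab kl. if kl = (i, j) then vectorize (N x) $ ab else stein_mat (L x) $ ab $ kl)
      $ ab $ kl) differentiable (at a)" for ab kl
    using S V by (cases "kl = (i, j)") simp_all
  then show ?thesis
    unfolding stein_solution_def
    using assms(3) S by (simp add: differentiable_det)
qed

lemma continuous_on_matrix_mult:
  fixes F :: "'a::topological_space \<Rightarrow> real^'k^'l" and G :: "'a \<Rightarrow> real^'m^'k"
  assumes "continuous_on U F" "continuous_on U G"
  shows "continuous_on U (\<lambda>x. F x ** G x)"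
  unfolding matrix_matrix_mult_def using assms by (intro continuous_intros)

lemma continuous_on_mpow:
  fixes F :: "'a::topological_space \<Rightarrow> real^'n^'n"
  assumes "continuous_on U F"
  shows "continuous_on U (\<lambda>x. mpow (F x) k)"
  by (induction k) (simp_all add: mpow_Suc continuous_on_matrix_mult assms)

section \<open>Gradients and invariant directions\<close>

text \<open>By finite dimension, a derivative is the inner product with the vector of its values on the standard
basis; that vector is the only one representing it, so the definite description in \<open>gradient\<close> is proper.\<close>
lemma GDERIV_gradient:
  fixes f :: "'a::euclidean_space \<Rightarrow> real"
  assumes "f differentiable (at x)"
  shows "GDERIV f x :> gradient f x"
proof -
  obtain f' where f': "(f has_derivative f') (at x)"
    using assms by (auto simp: differentiable_def)
  then interpret bounded_linear f' by (rule has_derivative_bounded_linear)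
  define D where "D = (\<Sum>b\<in>Basis. f' b *\<^sub>R b)"
  have "f' = (\<lambda>h. h \<bullet> D)"
  proof
    fix h
    have "f' h = f' (\<Sum>b\<in>Basis. (h \<bullet> b) *\<^sub>R b)" by (simp add: euclidean_representation)
    also have "\<dots> = h \<bullet> D" by (simp add: sum scaleR D_def inner_sum_right mult.commute)
    finally show "f' h = h \<bullet> D" .
  qed
  then have D: "GDERIV f x :> D" using f' by (simp add: gderiv_def)
  moreover have "E = D" if "GDERIV f x :> E" for E
    using has_derivative_unique[of f _ x] that D
    unfolding gderiv_def by (metis vector_eq_ldot)
  ultimately show ?thesis
    unfolding gradient_def by (rule theI)
qed

lemma gradient_orthogonal_invariant_direction:
  fixes f :: "'a::euclidean_space \<Rightarrow> real"
  assumes "f differentiable (at x)" and "\<And>t. f (x + t *\<^sub>R w) = f x"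
  shows "gradient f x \<bullet> w = 0"
proof -
  have f: "(f has_derivative (\<lambda>h. h \<bullet> gradient f x)) (at (x + 0 *\<^sub>R w))"
    using GDERIV_gradient[OF assms(1)] by (simp add: gderiv_def)
  have line: "((\<lambda>t. x + t *\<^sub>R w) has_derivative (\<lambda>t. t *\<^sub>R w)) (at 0)"
    by (auto intro!: derivative_eq_intros)
  have "((\<lambda>t. f (x + t *\<^sub>R w)) has_derivative (\<lambda>t. (t *\<^sub>R w) \<bullet> gradient f x)) (at 0)"
    by (rule has_derivative_compose[OF line f])
  moreover have "((\<lambda>t. f (x + t *\<^sub>R w)) has_derivative (\<lambda>t. 0)) (at 0)"
    by (simp add: assms(2))
  ultimately have "(\<lambda>t. (t *\<^sub>R w) \<bullet> gradient f x) = (\<lambda>t. 0)"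
    by (rule has_derivative_unique)
  from fun_cong[OF this, of 1] show ?thesis by (simp add: inner_commute)
qed

lemma orth_proj_eq_0:
  assumes "0 \<in> F" and "\<And>w. w \<in> F \<Longrightarrow> x \<bullet> w = 0"
  shows "orth_proj F x = 0"
  unfolding orth_proj_def
proof (rule the_equality)
  show "0 \<in> F \<and> (\<forall>w\<in>F. orthogonal (x - 0) w)" using assms by (simp add: orthogonal_def)
next
  fix y assume "y \<in> F \<and> (\<forall>w\<in>F. orthogonal (x - y) w)"
  then have "(x - y) \<bullet> y = 0" "x \<bullet> y = 0" using assms(2) by (auto simp: orthogonal_def)
  then show "y = 0" by (simp add: inner_diff_left)
qed

section \<open>The cost of input-output feedback\<close>

lemma psd_congruence:
  assumes "psd M"
  shows "psd (transpose X ** M ** X)"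
proof -
  have "0 \<le> x \<bullet> ((transpose X ** M ** X) *v x)" for x
    unfolding quadratic_form_congruence using assms by (simp add: psd_def)
  then show ?thesis
    using assms by (simp add: psd_def symmetric_mat_def matrix_transpose_mul matrix_mul_assoc)
qed

lemma psd_add: "psd M \<Longrightarrow> psd N \<Longrightarrow> psd (M + N)"
  by (simp add: psd_def symmetric_mat_def transpose_add matrix_vector_mult_add_rdistrib
      inner_add_right)

lemma pos_def_imp_psd: "pos_def M \<Longrightarrow> psd M"
  unfolding psd_def pos_def_def by (metis inner_zero_left less_eq_real_def)

text \<open>Near \<open>K\<close> the cost coincides with the trace formed from Cramer's solution, which is differentiable because
the data \<open>L\<close> and \<open>N\<close> of the Stein equation are polynomial in the gain.\<close>
lemma cost_differentiable:
  fixes A :: "real^'n^'n" and B :: "real^'m^'n" and C :: "real^'n^'d"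
    and K :: "real^(('p::{finite,linorder} \<times> 'm) + ('p \<times> 'd))^'m"
  assumes "psd Q" and "psd R" and "K \<in> feasible A B C"
  shows "cost A B C Q R Sigma0 differentiable (at K)"
proof -
  let ?Sd = "right_pinv (S_mat A B C :: real^(('p \<times> 'm) + ('p \<times> 'd))^'n)"
  define L where "L X = closed_loop A B C X"
    for X :: "real^(('p \<times> 'm) + ('p \<times> 'd))^'m"
  define N where "N X = transpose C ** Q ** C + transpose ?Sd ** transpose X ** R ** X ** ?Sd"
    for X :: "real^(('p \<times> 'm) + ('p \<times> 'd))^'m"
  have N_psd: "psd (N X)" for X
  proof -
    have "transpose ?Sd ** transpose X ** R ** X ** ?Sd = transpose (X ** ?Sd) ** R ** (X ** ?Sd)"
      by (simp add: matrix_transpose_mul matrix_mul_assoc)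
    then show ?thesis unfolding N_def using assms(1,2) by (simp add: psd_add psd_congruence)
  qed
  have "(\<lambda>k. mpow (L K) k) \<longlonglongrightarrow> 0"
    using assms(3) unfolding feasible_def L_def by (intro mpow_tendsto_0) simp
  from LIMSEQ_D[OF this zero_less_one] obtain k where k: "norm (mpow (L K) k) < 1" by auto
  \<comment> \<open>For this fixed \<open>k\<close>, the gains in \<open>U\<close> share the properties of \<open>K\<close> that the Stein equation needs.\<close>
  define U where "U = {X. norm (mpow (L X) k) < 1}"
  have "continuous_on UNIV L"
    unfolding L_def closed_loop_def
    by (intro continuous_intros continuous_on_matrix_mult)
  then have "open U"
    unfolding U_def by (intro open_Collect_less continuous_intros continuous_on_mpow)
  have cost: "trace (stein_solution (L X) (N X) ** Sigma0) = cost A B C Q R Sigma0 X" if "X \<in> U" for X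
    using the_psd_stein_solution[OF _ N_psd, of "L X" k X] that
    by (simp add: U_def cost_def cost_mat_def L_def N_def)
  have ent: "(\<lambda>X. X $ i $ j) differentiable (at K)" for i j
    by (intro bounded_linear_imp_differentiable bounded_linear_vec_nth
        bounded_linear_compose[OF bounded_linear_vec_nth])
  have L': "(\<lambda>X. L X $ i $ j) differentiable (at K)" for i j
    unfolding L_def closed_loop_def
    by (simp add: differentiable_matrix_mult ent)
  have ent': "(\<lambda>X. transpose X $ i $ j) differentiable (at K)" for i j
    using ent by (simp add: transpose_def)
  have N': "(\<lambda>X. N X $ i $ j) differentiable (at K)" for i j
    unfolding N_def by (simp add: differentiable_matrix_mult ent ent')
  have "(\<lambda>X. trace (stein_solution (L X) (N X) ** Sigma0)) differentiable (at K)"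
    unfolding trace_def
    by (intro differentiable_sum ballI differentiable_matrix_mult differentiable_stein_solution
        L' N' det_stein_mat_nonzero[OF k]) simp_all
  then obtain D where
    "((\<lambda>X. trace (stein_solution (L X) (N X) ** Sigma0)) has_derivative D) (at K)"
    by (auto simp: differentiable_def)
  from has_derivative_transform_within_open[OF this \<open>open U\<close> _ cost] k
  have "(cost A B C Q R Sigma0 has_derivative D) (at K)" by (simp add: U_def)
  then show ?thesis by (auto simp: differentiable_def)
qed

text \<open>Both the closed loop and the running cost of inputs involve the gain only through its product with
\<open>S\<^sup>\<dagger>\<close>.\<close>
lemma cost_eq_if_state_gain_eq:
  assumes "X ** right_pinv (S_mat A B C) = Y ** right_pinv (S_mat A B C)"
  shows "cost A B C Q R Sigma0 X = cost A B C Q R Sigma0 Y"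
proof -
  let ?Sd = "right_pinv (S_mat A B C)"
  have loop: "closed_loop A B C Z = A - B ** (Z ** ?Sd)" for Z
    by (simp add: closed_loop_def matrix_mul_assoc)
  have weight: "transpose ?Sd ** transpose Z ** R ** Z ** ?Sd
      = transpose (Z ** ?Sd) ** R ** (Z ** ?Sd)" for Z
    by (simp add: matrix_transpose_mul matrix_mul_assoc)
  show ?thesis unfolding cost_def cost_mat_def loop weight assms ..
qed

theorem lemma8:
  fixes A :: "real^'n^'n" and B :: "real^'m^'n" and C :: "real^'n^'d"
    and Q :: "real^'d^'d" and R :: "real^'m^'m" and Sigma0 :: "real^'n^'n"
    and M :: "'w measure" and x0 :: "'w \<Rightarrow> real^'n"
    and K :: "real^(('p::{finite,linorder} \<times> 'm) + ('p \<times> 'd))^'m"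
  assumes "controllable A B" and "observable C A"
    and "psd Q" and "pos_def R"
    and "prob_space M" and "x0 \<in> borel_measurable M"
    and "\<And>i. integrable M (\<lambda>w. (x0 w $ i)\<^sup>2)"
    and "(\<integral>w. x0 w \<partial>M) = 0"
    and "Sigma0 = second_moment M x0" and "pos_def Sigma0"
    and "CARD('p) = max (obsv_index A C) (ctrb_index A B)"
    and "K \<in> feasible A B C"
  shows "orth_proj (null_gains A B C) (gradient (cost A B C Q R Sigma0) K) = 0"
proof (rule orth_proj_eq_0)
  show "0 \<in> null_gains A B C"
    by (simp add: null_gains_def vec_eq_iff matrix_matrix_mult_def)
next
  fix D :: "real^(('p \<times> 'm) + ('p \<times> 'd))^'m"
  assume D: "D \<in> null_gains A B C"
  show "gradient (cost A B C Q R Sigma0) K \<bullet> D = 0"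
  proof (rule gradient_orthogonal_invariant_direction)
    show "cost A B C Q R Sigma0 differentiable (at K)"
      using assms(3,12) pos_def_imp_psd[OF assms(4)] by (intro cost_differentiable)
    show "cost A B C Q R Sigma0 (K + t *\<^sub>R D) = cost A B C Q R Sigma0 K" for t
      using D by (intro cost_eq_if_state_gain_eq)
        (simp add: null_gains_def vec_eq_iff matrix_matrix_mult_def distrib_right sum.distrib
          mult.assoc flip: sum_distrib_left)
  qed
qed

end
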